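(* Let $X,Z,V$ represent the meta-Hahn algebra on a real vector space $\mathfrak V_N$ of dimension $N+1$ with scalar product $(\cdot,\cdot)$, let $W=X+\mu Z$ with $\mu\in\mathbb R$, and let $\{e_m\},\{e^*_m\},\{f_n\},\{f^*_n\}$ be as in the context. Then the functions $S_m(n)=(f^*_n,e_m)$ are bispectral: for all $m,n=0,\dots,N$ they obey the three-term recurrence relation $$\rho_nS_m(n)=W^{(e)}_{m+1,m}S_{m+1}(n)+W^{(e)}_{m,m}S_m(n)+W^{(e)}_{m-1,m}S_{m-1}(n)$$ and the difference equation $$\nu_mS_m(n)=V^{(f^* )T}_{n+1,n}S_m(n+1)+V^{(f^* )T}_{n,n}S_m(n)+V^{(f^* )T}_{n-1,n}S_m(n-1).$$ Moreover they are proportional to orthogonal polynomials: there are polynomials $P_m$ of degree $m$, with $P_0=1$, forming a family of orthogonal polynomials on the points $\rho_0,\dots,\rho_N$, such that $S_m(n)=S_0(n)P_m(\rho_n)$. The functions $\tilde S_m(n)=(f_n,e^*_m)$ are expressed in terms of the same polynomials: $\tilde S_m(n)=h(m)\tilde S_0(n)P_m(\rho_n)$ for some nonzero function $h(m)$ of $m$.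
   Context: $[A,B]=AB-BA$, $\{A,B\}=AB+BA$. Representing the meta-Hahn algebra (real parameters $\eta_0,\eta_1,\eta_3$) means that $$[Z,X]=Z^2+Z,\qquad [X,V]=\{V,Z\}+\eta_1X+V-\eta_1Z+\eta_0\mathcal I,\qquad [V,Z]=2X+\eta_1Z+\eta_3\mathcal I .$$ $A^T$ is the transpose of $A$ with respect to the scalar product. All bases are indexed by $0,\dots,N$; terms with index or argument $-1$ or $N+1$ are zero. Setting: - $\{e_m\},\{e_m^*\}$ are bases with $Ve_m=\nu_me_m$, $V^Te^*_m=\nu_me^*_m$; $\{f_n\},\{f_n^*\}$ are bases with $Wf_n=\rho_nf_n$, $W^Tf^*_n=\rho_nf^*_n$; the real eigenvalues $\nu_m$ are pairwise distinct, as are the real $\rho_n$. - $V,W$ form a Leonard pair: $We_m=\sum_{|k-m|\le1}W^{(e)}_{k,m}e_k$ and $Vf_n=\sum_{|k-n|\le1}V^{(f)}_{k,n}f_k$ with all off-diagonal (sub- and superdiagonal) entries nonzero; moreover $W^{(e)}_{m,m-1}W^{(e)}_{m-1,m}>0$ for $1\le m\le N$. - $V^{(f^* )T}_{k,n}$ denotes the matrix entries of $V^T$ in the basis $\{f^*_n\}$: $V^Tf^*_n=\sum_kV^{(f^* )T}_{k,n}f^*_k$. *)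

theory Defs
  imports "HOL-Analysis.Analysis" "HOL-Computational_Algebra.Polynomial"
begin

definition commutator :: "('a::real_vector \<Rightarrow> 'a) \<Rightarrow> ('a \<Rightarrow> 'a) \<Rightarrow> 'a \<Rightarrow> 'a" where
  "commutator A B = (\<lambda>v. A (B v) - B (A v))"

definition anticommutator :: "('a::real_vector \<Rightarrow> 'a) \<Rightarrow> ('a \<Rightarrow> 'a) \<Rightarrow> 'a \<Rightarrow> 'a" where
  "anticommutator A B = (\<lambda>v. A (B v) + B (A v))"

definition meta_Hahn_rep ::
  "real \<Rightarrow> real \<Rightarrow> real \<Rightarrow> ('a::real_vector \<Rightarrow> 'a) \<Rightarrow> ('a \<Rightarrow> 'a) \<Rightarrow> ('a \<Rightarrow> 'a) \<Rightarrow> bool" where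
  "meta_Hahn_rep \<eta>0 \<eta>1 \<eta>3 X Z V \<longleftrightarrow>
     linear X \<and> linear Z \<and> linear V \<and>
     commutator Z X = (\<lambda>v. Z (Z v) + Z v) \<and>
     commutator X V =
       (\<lambda>v. anticommutator V Z v + \<eta>1 *\<^sub>R X v + V v - \<eta>1 *\<^sub>R Z v + \<eta>0 *\<^sub>R v) \<and>
     commutator V Z = (\<lambda>v. 2 *\<^sub>R X v + \<eta>1 *\<^sub>R Z v + \<eta>3 *\<^sub>R v)"

definition indexed_basis :: "nat \<Rightarrow> (nat \<Rightarrow> 'a::real_vector) \<Rightarrow> bool" where
  "indexed_basis N b \<longleftrightarrow>
     inj_on b {..N} \<and> independent (b ` {..N}) \<and> span (b ` {..N}) = UNIV"

definition eigenbasis ::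
  "nat \<Rightarrow> ('a::real_vector \<Rightarrow> 'a) \<Rightarrow> (nat \<Rightarrow> real) \<Rightarrow> (nat \<Rightarrow> 'a) \<Rightarrow> bool" where
  "eigenbasis N A ev b \<longleftrightarrow> indexed_basis N b \<and> (\<forall>m\<le>N. A (b m) = ev m *\<^sub>R b m)"

text \<open>\<open>M k m\<close> is the coefficient of \<open>b k\<close> in \<open>A (b m)\<close>; only its values within the band are
  relevant.\<close>

definition irreducible_tridiagonal ::
  "nat \<Rightarrow> ('a::real_vector \<Rightarrow> 'a) \<Rightarrow> (nat \<Rightarrow> 'a) \<Rightarrow> (nat \<Rightarrow> nat \<Rightarrow> real) \<Rightarrow> bool" where
  "irreducible_tridiagonal N A b M \<longleftrightarrow>
     (\<forall>m\<le>N. A (b m) = (\<Sum>k | k \<le> N \<and> \<bar>int k - int m\<bar> \<le> 1. M k m *\<^sub>R b k)) \<and>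
     (\<forall>m<N. M (Suc m) m \<noteq> 0 \<and> M m (Suc m) \<noteq> 0)"

definition orthogonal_on_points :: "nat \<Rightarrow> (nat \<Rightarrow> real) \<Rightarrow> (nat \<Rightarrow> real poly) \<Rightarrow> bool" where
  "orthogonal_on_points N \<rho> P \<longleftrightarrow>
     (\<exists>w. (\<forall>n\<le>N. w n > 0) \<and>
       (\<forall>m\<le>N. \<forall>k\<le>N. (\<Sum>n\<le>N. w n * poly (P m) (\<rho> n) * poly (P k) (\<rho> n)) = 0 \<longleftrightarrow> m \<noteq> k))"

end

theory Submission imports Defs begin

text \<open>
  Eigenvectors of an operator and of its adjoint for distinct eigenvalues are biorthogonal. Hence
  the tridiagonal action of \<open>W\<close> on \<open>e\<close> gives the recurrence of \<open>S\<close>, and the action of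
  \<open>V\<close> on \<open>f\<close> transposes to a tridiagonal action of the adjoint of \<open>V\<close> on \<open>f\<^sup>*\<close>, which gives the
  difference equation. The recurrence generates the polynomials \<open>P\<^sub>m\<close>. The coordinates of
  \<open>f\<^sub>n\<close> in the basis \<open>e\<close> satisfy the transposed recurrence, which the diagonal rescaling by
  \<open>g\<^sub>m = (\<Prod>j<m. W\<^sub>j\<^sub>+\<^sub>1\<^sub>,\<^sub>j / W\<^sub>j\<^sub>,\<^sub>j\<^sub>+\<^sub>1)\<close> turns into the original one. Orthogonality is the
  resolution of the identity over \<open>f\<close> applied to \<open>(e\<^sub>m, e\<^sup>*\<^sub>k)\<close>; the
  resolution of the identity over \<open>e\<close> applied to \<open>(f\<^sub>n, f\<^sup>*\<^sub>n)\<close> shows that the weight at \<open>\<rho>\<^sub>n\<close> is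
  the inverse of \<open>\<Sum>m. g\<^sub>m P\<^sub>m(\<rho>\<^sub>n)\<^sup>2\<close>, which is positive because every \<open>g\<^sub>m\<close> is.
\<close>

section \<open>Biorthogonal eigenbases and the resolution of the identity\<close>

lemma eigenbases_biorthogonal:
  fixes A :: "'a::euclidean_space \<Rightarrow> 'a"
  assumes "linear A" and a: "eigenbasis N A ev a" and b: "eigenbasis N (adjoint A) ev b"
    and inj: "inj_on ev {..N}" and m: "m \<le> N" and k: "k \<le> N"
  shows "a m \<bullet> b k = 0 \<longleftrightarrow> m \<noteq> k"
proof -
  have orth: "a i \<bullet> b k = 0" if "i \<le> N" "i \<noteq> k" for i
  proof -
    have "a i \<bullet> adjoint A (b k) = A (a i) \<bullet> b k"
      using \<open>linear A\<close> by (rule adjoint_works)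
    then have "ev k * (a i \<bullet> b k) = ev i * (a i \<bullet> b k)"
      using a b that k by (simp add: eigenbasis_def)
    moreover have "ev i \<noteq> ev k"
      using inj that k by (auto simp: inj_on_def)
    ultimately show ?thesis by simp
  qed
  \<comment> \<open>If this pairing vanished too, \<open>b k\<close> would be orthogonal to the
    spanning family \<open>a\<close>, hence to itself, whereas basis vectors are nonzero.\<close>
  have "a k \<bullet> b k \<noteq> 0"
  proof
    assume "a k \<bullet> b k = 0"
    then have "b k \<bullet> v = 0" if "v \<in> a ` {..N}" for v
      using that orth by (auto simp: inner_commute)
    then have "orthogonal (b k) (b k)"
      using a orthogonal_to_span[of "b k" "a ` {..N}" "b k"]
      by (simp add: eigenbasis_def indexed_basis_def orthogonal_def)
    then have "b k = 0" by (simp add: orthogonal_def)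
    moreover have "0 \<notin> b ` {..N}"
      using b dependent_zero unfolding eigenbasis_def indexed_basis_def by metis
    ultimately show False using k by force
  qed
  then show ?thesis using orth m by metis
qed

text \<open>The remainder of \<open>u\<close> after its expansion along \<open>a\<close> pairs to
  zero with every \<open>b k\<close>, hence with every vector, since \<open>b\<close> spans. It is
  applied to the pair \<open>e\<close>, \<open>es\<close> and to the pair \<open>f\<close>,
  \<open>fs\<close>.\<close>

lemma biorthogonal_inner_expansion:
  fixes a b :: "nat \<Rightarrow> 'a::euclidean_space"
  assumes b: "indexed_basis N b"
    and biorth: "\<And>m k. m \<le> N \<Longrightarrow> k \<le> N \<Longrightarrow> a m \<bullet> b k = 0 \<longleftrightarrow> m \<noteq> k"
  shows "u \<bullet> v = (\<Sum>m\<le>N. (u \<bullet> b m) * (a m \<bullet> v) / (a m \<bullet> b m))"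
proof -
  define r where "r = u - (\<Sum>m\<le>N. ((u \<bullet> b m) / (a m \<bullet> b m)) *\<^sub>R a m)"
  have "r \<bullet> b k = 0" if "k \<le> N" for k
  proof -
    have "(\<Sum>m\<le>N. (u \<bullet> b m) / (a m \<bullet> b m) * (a m \<bullet> b k)) =
        (\<Sum>m\<le>N. if m = k then u \<bullet> b k else 0)"
      using biorth that by (intro sum.cong) auto
    then show ?thesis
      using that by (simp add: r_def inner_diff_left inner_sum_left)
  qed
  then have "orthogonal r v"
    using b orthogonal_to_span[of v "b ` {..N}" r]
    by (auto simp: indexed_basis_def orthogonal_def)
  then show ?thesis
    by (simp add: r_def orthogonal_def inner_diff_left inner_sum_left)
qed

section \<open>Sums over a tridiagonal band\<close>

lemma sum_tridiagonal:
  fixes F :: "nat \<Rightarrow> 'b::comm_monoid_add"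
  assumes "m \<le> N"
  shows "(\<Sum>k | k \<le> N \<and> \<bar>int k - int m\<bar> \<le> 1. F k) =
    (if m < N then F (m + 1) else 0) + F m + (if 0 < m then F (m - 1) else 0)"
proof -
  \<comment> \<open>The guards express that terms of index -1 and N + 1 are zero. Without
    \<open>0 < m\<close>, truncated subtraction would count \<open>F 0\<close> twice.\<close>
  have "{k. k \<le> N \<and> \<bar>int k - int m\<bar> \<le> 1} =
      (if m < N then {m + 1} else {}) \<union> {m} \<union> (if 0 < m then {m - 1} else {})"
    using assms by auto
  then show ?thesis by (auto simp: add_ac)
qed

lemma sum_banded:
  fixes F :: "nat \<Rightarrow> 'b::comm_monoid_add"
  assumes "m \<le> N" and "\<And>k. k \<le> N \<Longrightarrow> \<bar>int k - int m\<bar> > 1 \<Longrightarrow> F k = 0"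
  shows "(\<Sum>k\<le>N. F k) =
    (if m < N then F (m + 1) else 0) + F m + (if 0 < m then F (m - 1) else 0)"
proof -
  have "(\<Sum>k\<le>N. F k) = (\<Sum>k | k \<le> N \<and> \<bar>int k - int m\<bar> \<le> 1. F k)"
    using assms(2) by (intro sum.mono_neutral_right) (auto simp: not_le[symmetric])
  then show ?thesis by (simp only: sum_tridiagonal[OF assms(1)])
qed

text \<open>Pairing with a dual vector isolates one matrix entry. Together with
  \<open>adjoint_works\<close> this transfers a band from an operator to its adjoint.\<close>

lemma irreducible_tridiagonal_inner:
  assumes "irreducible_tridiagonal N A b M"
    and biorth: "\<And>m k. m \<le> N \<Longrightarrow> k \<le> N \<Longrightarrow> b m \<bullet> c k = 0 \<longleftrightarrow> m \<noteq> k"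
    and "m \<le> N" "k \<le> N"
  shows "A (b m) \<bullet> c k = (if \<bar>int k - int m\<bar> \<le> 1 then M k m * (b k \<bullet> c k) else 0)"
proof -
  have "A (b m) \<bullet> c k =
      (\<Sum>i | i \<le> N \<and> \<bar>int i - int m\<bar> \<le> 1. M i m * (b i \<bullet> c k))"
    using assms by (simp add: irreducible_tridiagonal_def inner_sum_left)
  also have "\<dots> = (\<Sum>i | i \<le> N \<and> \<bar>int i - int m\<bar> \<le> 1.
      if i = k then M k m * (b k \<bullet> c k) else 0)"
    using biorth \<open>k \<le> N\<close> by (intro sum.cong) auto
  finally show ?thesis using \<open>k \<le> N\<close> by simp
qed

section \<open>Polynomials generated by a three-term recurrence\<close>

fun tridiagonal_poly :: "(nat \<Rightarrow> nat \<Rightarrow> real) \<Rightarrow> nat \<Rightarrow> real poly" where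
  "tridiagonal_poly M 0 = 1"
| "tridiagonal_poly M (Suc 0) = smult (1 / M 1 0) [:- M 0 0, 1:]"
| "tridiagonal_poly M (Suc (Suc m)) = smult (1 / M (Suc (Suc m)) (Suc m))
     ([:- M (Suc m) (Suc m), 1:] * tridiagonal_poly M (Suc m)
      - smult (M m (Suc m)) (tridiagonal_poly M m))"

text \<open>The linear factor raises the degree by one, the subtracted term has smaller degree, and
  the scalar in front is nonzero.\<close>

lemma degree_tridiagonal_poly:
  assumes "\<And>m. m < N \<Longrightarrow> M (Suc m) m \<noteq> 0" and "m \<le> N"
  shows "degree (tridiagonal_poly M m) = m"
  using \<open>m \<le> N\<close>
proof (induction m rule: less_induct)
  case (less m)
  consider "m = 0" | "m = Suc 0" | k where "m = Suc (Suc k)"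
    by (metis nat.exhaust)
  then show ?case
  proof cases
    case 1
    then show ?thesis by simp
  next
    case 2
    then show ?thesis using less.prems assms(1)[of 0] by simp
  next
    case (3 k)
    let ?q = "[:- M (Suc k) (Suc k), 1:] * tridiagonal_poly M (Suc k)"
    let ?r = "smult (M k (Suc k)) (tridiagonal_poly M k)"
    have IH: "degree (tridiagonal_poly M (Suc k)) = Suc k" "degree (tridiagonal_poly M k) = k"
      using less 3 by auto
    then have "tridiagonal_poly M (Suc k) \<noteq> 0" by force
    then have "degree ?q = Suc (Suc k)"
      using IH by (subst degree_mult_eq) auto
    moreover have "degree ?r \<le> k"
      using IH degree_smult_le by metis
    ultimately have "degree (?q - ?r) = Suc (Suc k)"
      using degree_add_eq_left[of "- ?r" ?q] by simp
    then show ?thesis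
      using 3 less.prems assms(1)[of "Suc k"] by simp
  qed
qed

text \<open>Each row \<open>m < N\<close> can be solved for \<open>s (Suc m)\<close>, so
  \<open>s 0\<close> determines the whole sequence; row \<open>N\<close> would produce no further
  value and only constrain \<open>x\<close>.\<close>

lemma three_term_recurrence_solution:
  assumes nz: "\<And>m. m < N \<Longrightarrow> M (Suc m) m \<noteq> 0"
    and rec: "\<And>m. m < N \<Longrightarrow> x * s m = M (Suc m) m * s (Suc m) + M m m * s m
      + (if 0 < m then M (m - 1) m * s (m - 1) else 0)"
    and "m \<le> N"
  shows "s m = s 0 * poly (tridiagonal_poly M m) x"
  using \<open>m \<le> N\<close>
proof (induction m rule: less_induct)
  case (less m)
  consider "m = 0" | "m = Suc 0" | k where "m = Suc (Suc k)"
    by (metis nat.exhaust)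
  then show ?case
  proof cases
    case 1
    then show ?thesis by simp
  next
    case 2
    have "M 1 0 * s 1 = (x - M 0 0) * s 0"
      using rec[of 0] less.prems 2 by (simp add: algebra_simps)
    then have "s 1 = (x - M 0 0) * s 0 / M 1 0"
      using nz[of 0] less.prems 2 by (simp add: eq_divide_eq mult.commute)
    then show ?thesis
      by (simp add: 2 diff_divide_distrib right_diff_distrib mult.commute)
  next
    case (3 k)
    have IH: "s (Suc k) = s 0 * poly (tridiagonal_poly M (Suc k)) x"
      "s k = s 0 * poly (tridiagonal_poly M k) x"
      using less.prems 3 by (intro less.IH; simp)+
    have "M m (Suc k) * s m = (x - M (Suc k) (Suc k)) * s (Suc k) - M k (Suc k) * s k"
      using rec[of "Suc k"] less.prems 3 by (simp add: algebra_simps)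
    moreover have "M m (Suc k) \<noteq> 0"
      using nz[of "Suc k"] less.prems 3 by simp
    ultimately have "s m = ((x - M (Suc k) (Suc k)) * s (Suc k) - M k (Suc k) * s k) / M m (Suc k)"
      by (metis nonzero_mult_div_cancel_left)
    also have "\<dots> = s 0 * poly (tridiagonal_poly M m) x"
      unfolding IH by (simp add: 3 add_divide_distrib diff_divide_distrib algebra_simps)
    finally show ?thesis .
  qed
qed

section \<open>Symmetrising a tridiagonal matrix\<close>

definition symmetrizer :: "(nat \<Rightarrow> nat \<Rightarrow> real) \<Rightarrow> nat \<Rightarrow> real" where
  "symmetrizer M m = (\<Prod>j<m. M (Suc j) j / M j (Suc j))"

lemma symmetrizer_0 [simp]: "symmetrizer M 0 = 1"
  by (simp add: symmetrizer_def)

lemma symmetrizer_pos: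
  assumes "\<And>m. m < N \<Longrightarrow> M (Suc m) m * M m (Suc m) > 0" and "m \<le> N"
  shows "symmetrizer M m > 0"
  unfolding symmetrizer_def
  using assms by (intro prod_pos) (auto simp: zero_less_divide_iff zero_less_mult_iff)

text \<open>This is detailed balance: multiplying each column \<open>m\<close> of the tridiagonal
  matrix by \<open>symmetrizer M m\<close> makes it symmetric.\<close>

lemma symmetrizer_Suc:
  assumes "M m (Suc m) \<noteq> 0"
  shows "M m (Suc m) * symmetrizer M (Suc m) = M (Suc m) m * symmetrizer M m"
  using assms by (simp add: symmetrizer_def)

lemma transposed_recurrence_solution:
  assumes pos: "\<And>m. m < N \<Longrightarrow> M (Suc m) m * M m (Suc m) > 0"
    and rec: "\<And>m. m < N \<Longrightarrow> x * t m = M m (Suc m) * t (Suc m) + M m m * t m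
      + (if 0 < m then M m (m - 1) * t (m - 1) else 0)"
    and "m \<le> N"
  shows "t m = symmetrizer M m * t 0 * poly (tridiagonal_poly M m) x"
proof -
  let ?g = "symmetrizer M"
  have g: "?g k \<noteq> 0" if "k \<le> N" for k
    using symmetrizer_pos[where M = M, OF pos that] by simp
  have nz: "M (Suc k) k \<noteq> 0" "M k (Suc k) \<noteq> 0" if "k < N" for k
    using pos[OF that] by auto
  \<comment> \<open>Detailed balance trades each transposed coefficient for an original one:
    \<open>up\<close> handles the term at \<open>Suc k\<close>, and its instance at
    \<open>k - 1\<close> gives \<open>down\<close>.\<close>
  have up: "M k (Suc k) = M (Suc k) k * ?g k / ?g (Suc k)" if "k < N" for k
    using symmetrizer_Suc[of M k] nz(2)[OF that] g[of "Suc k"] that by (simp add: field_simps)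
  have "t m / ?g m = t 0 / ?g 0 * poly (tridiagonal_poly M m) x"
  proof (rule three_term_recurrence_solution[where N = N])
    fix k assume k: "k < N"
    have down: "M k (k - 1) * t (k - 1) / ?g k = M (k - 1) k * (t (k - 1) / ?g (k - 1))" if "0 < k"
      using up[of "k - 1"] g[of k] g[of "k - 1"] that k by (simp add: field_simps)
    have "x * (t k / ?g k) = (M k (Suc k) * t (Suc k) + M k k * t k
      + (if 0 < k then M k (k - 1) * t (k - 1) else 0)) / ?g k"
      using rec[OF k] by simp
    also have "\<dots> = M k (Suc k) * t (Suc k) / ?g k + M k k * (t k / ?g k)
      + (if 0 < k then M k (k - 1) * t (k - 1) / ?g k else 0)"
      by (simp add: add_divide_distrib)
    also have "M k (Suc k) * t (Suc k) / ?g k = M (Suc k) k * (t (Suc k) / ?g (Suc k))"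
      using up[OF k] g[of k] k by simp
    finally show "x * (t k / ?g k) = M (Suc k) k * (t (Suc k) / ?g (Suc k)) + M k k * (t k / ?g k)
      + (if 0 < k then M (k - 1) k * (t (k - 1) / ?g (k - 1)) else 0)"
      using down by simp
  qed (use nz \<open>m \<le> N\<close> in auto)
  then show ?thesis using g[OF \<open>m \<le> N\<close>] by (simp add: field_simps)
qed

section \<open>Bispectrality and orthogonality of the functions \<open>S\<close>\<close>

theorem proposition5p4:
  fixes X Z V W :: "'a::euclidean_space \<Rightarrow> 'a"
    and N :: nat
    and \<eta>0 \<eta>1 \<eta>3 \<mu> :: real
    and e es f fs :: "nat \<Rightarrow> 'a"
    and \<nu> \<rho> :: "nat \<Rightarrow> real"
    and We Vf VfsT :: "nat \<Rightarrow> nat \<Rightarrow> real"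
    and S St :: "nat \<Rightarrow> nat \<Rightarrow> real"
  assumes dim: "DIM('a) = N + 1"
    and rep: "meta_Hahn_rep \<eta>0 \<eta>1 \<eta>3 X Z V"
    and W: "W = (\<lambda>v. X v + \<mu> *\<^sub>R Z v)"
    and e: "eigenbasis N V \<nu> e"
    and es: "eigenbasis N (adjoint V) \<nu> es"
    and f: "eigenbasis N W \<rho> f"
    and fs: "eigenbasis N (adjoint W) \<rho> fs"
    and \<nu>: "inj_on \<nu> {..N}"
    and \<rho>: "inj_on \<rho> {..N}"
    and We: "irreducible_tridiagonal N W e We"
    and Vf: "irreducible_tridiagonal N V f Vf"
    and pos: "\<forall>m\<in>{1..N}. We m (m - 1) * We (m - 1) m > 0"
    and VfsT: "\<forall>n\<le>N. adjoint V (fs n) = (\<Sum>k\<le>N. VfsT k n *\<^sub>R fs k)"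
    and S: "\<And>m n. S m n = fs n \<bullet> e m"
    and St: "\<And>m n. St m n = f n \<bullet> es m"
  shows "(\<forall>m\<le>N. \<forall>n\<le>N.
            \<rho> n * S m n =
              (if m < N then We (m + 1) m * S (m + 1) n else 0)
              + We m m * S m n
              + (if 0 < m then We (m - 1) m * S (m - 1) n else 0))
       \<and> (\<forall>m\<le>N. \<forall>n\<le>N.
            \<nu> m * S m n =
              (if n < N then VfsT (n + 1) n * S m (n + 1) else 0)
              + VfsT n n * S m n
              + (if 0 < n then VfsT (n - 1) n * S m (n - 1) else 0))
       \<and> (\<exists>P :: nat \<Rightarrow> real poly.
            (\<forall>m\<le>N. degree (P m) = m) \<and> P 0 = 1 \<and> orthogonal_on_points N \<rho> P
            \<and> (\<forall>m\<le>N. \<forall>n\<le>N. S m n = S 0 n * poly (P m) (\<rho> n))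
            \<and> (\<exists>h :: nat \<Rightarrow> real. (\<forall>m\<le>N. h m \<noteq> 0)
                 \<and> (\<forall>m\<le>N. \<forall>n\<le>N. St m n = h m * St 0 n * poly (P m) (\<rho> n))))"
proof -
  have linV: "linear V" and "linear X" "linear Z"
    using rep by (simp_all add: meta_Hahn_rep_def)
  then have linW: "linear W"
    unfolding W by (intro linear_compose_add linear_compose_scale_right)
  have ee: "e m \<bullet> es k = 0 \<longleftrightarrow> m \<noteq> k" if "m \<le> N" "k \<le> N" for m k
    using eigenbases_biorthogonal[OF linV e es \<nu> that] .
  have ff: "f m \<bullet> fs k = 0 \<longleftrightarrow> m \<noteq> k" if "m \<le> N" "k \<le> N" for m k
    using eigenbases_biorthogonal[OF linW f fs \<rho> that] .
  have Wpos: "We (Suc m) m * We m (Suc m) > 0" if "m < N" for m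
    using pos[rule_format, of "Suc m"] that by simp
  have Wnz: "We (Suc m) m \<noteq> 0" if "m < N" for m
    using Wpos[OF that] by auto

  have recurrence: "\<rho> n * S m n = (if m < N then We (m + 1) m * S (m + 1) n else 0)
      + We m m * S m n + (if 0 < m then We (m - 1) m * S (m - 1) n else 0)"
    if "m \<le> N" "n \<le> N" for m n
  proof -
    have "\<rho> n * S m n = W (e m) \<bullet> fs n"
      using adjoint_works[OF linW, of "e m" "fs n"] fs that
      by (simp add: S eigenbasis_def inner_commute)
    also have "\<dots> = (\<Sum>k | k \<le> N \<and> \<bar>int k - int m\<bar> \<le> 1. We k m * S k n)"
      using We that
      by (simp add: irreducible_tridiagonal_def inner_sum_left S inner_commute[of "fs n"])
    finally show ?thesis by (simp only: sum_tridiagonal[OF that(1)])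
  qed

  \<comment> \<open>\<open>VfsT\<close> is given only as a full matrix. Pairing with
    \<open>f k\<close> isolates one entry, and moving \<open>V\<close> onto \<open>f k\<close> makes
    it, up to nonzero factors, an entry of the tridiagonal matrix of \<open>V\<close> in the basis
    \<open>f\<close>.\<close>
  have VfsT_band: "VfsT k n = 0" if "k \<le> N" "n \<le> N" "\<bar>int k - int n\<bar> > 1" for k n
  proof -
    have "f k \<bullet> adjoint V (fs n) = (\<Sum>i\<le>N. VfsT i n * (f k \<bullet> fs i))"
      using VfsT that by (simp add: inner_sum_right)
    also have "\<dots> = (\<Sum>i\<le>N. if i = k then VfsT k n * (f k \<bullet> fs k) else 0)"
      using ff that by (intro sum.cong) auto
    finally have "VfsT k n * (f k \<bullet> fs k) = V (f k) \<bullet> fs n"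
      using that by (simp add: adjoint_works[OF linV])
    also have "\<dots> = 0"
      using irreducible_tridiagonal_inner[OF Vf ff that(1,2)] that(3) by simp
    finally show ?thesis using ff that by simp
  qed
  have difference: "\<nu> m * S m n = (if n < N then VfsT (n + 1) n * S m (n + 1) else 0)
      + VfsT n n * S m n + (if 0 < n then VfsT (n - 1) n * S m (n - 1) else 0)"
    if "m \<le> N" "n \<le> N" for m n
  proof -
    have "\<nu> m * S m n = e m \<bullet> adjoint V (fs n)"
      using adjoint_works[OF linV, of "e m" "fs n"] e that
      by (simp add: S eigenbasis_def inner_commute)
    also have "\<dots> = (\<Sum>k\<le>N. VfsT k n * S m k)"
      using VfsT that by (simp add: inner_sum_right S inner_commute[of "e m"])
    finally show ?thesis
      using sum_banded[OF that(2), of "\<lambda>k. VfsT k n * S m k"] VfsT_band that by simp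
  qed

  define P where "P = tridiagonal_poly We"
  define g where "g = symmetrizer We"
  define d where "d m = e m \<bullet> es m" for m
  define c where "c n = f n \<bullet> fs n" for n
  \<comment> \<open>This factor comes from solving
    \<open>St m n / d m = g m * (St 0 n / d 0) * poly (P m) (\<rho> n)\<close> for
    \<open>St m n\<close>.\<close>
  define h where "h m = g m * d m / d 0" for m
  have d: "d m \<noteq> 0" if "m \<le> N" for m using ee that by (simp add: d_def)
  have c: "c n \<noteq> 0" if "n \<le> N" for n using ff that by (simp add: c_def)
  have g: "g m > 0" if "m \<le> N" for m
    unfolding g_def by (rule symmetrizer_pos[where M = We, OF Wpos that])

  have S_poly: "S m n = S 0 n * poly (P m) (\<rho> n)" if "m \<le> N" "n \<le> N" for m n
    unfolding P_def
  proof (rule three_term_recurrence_solution[where N = N and s = "\<lambda>m. S m n"])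
    show "\<rho> n * S m n = We (Suc m) m * S (Suc m) n + We m m * S m n
      + (if 0 < m then We (m - 1) m * S (m - 1) n else 0)" if "m < N" for m
      using recurrence[of m n] that \<open>n \<le> N\<close> by simp
  qed (use Wnz that in auto)

  \<comment> \<open>\<open>St m n / d m\<close> is the coordinate of \<open>f n\<close> along
    \<open>e m\<close>, so this is the eigenvector equation of \<open>f n\<close> read
    coordinatewise.\<close>
  have transposed: "\<rho> n * (St m n / d m) =
      (if m < N then We m (m + 1) * (St (m + 1) n / d (m + 1)) else 0)
      + We m m * (St m n / d m) + (if 0 < m then We m (m - 1) * (St (m - 1) n / d (m - 1)) else 0)"
    if "m \<le> N" "n \<le> N" for m n
  proof -
    have "\<rho> n * St m n = f n \<bullet> adjoint W (es m)"
      using adjoint_works[OF linW, of "f n" "es m"] f that by (simp add: St eigenbasis_def)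
    also have "\<dots> = (\<Sum>k\<le>N. (f n \<bullet> es k) * (e k \<bullet> adjoint W (es m)) / (e k \<bullet> es k))"
      using es ee by (intro biorthogonal_inner_expansion) (auto simp: eigenbasis_def)
    also have "\<dots> = (\<Sum>k\<le>N. if \<bar>int m - int k\<bar> \<le> 1
        then d m * (We m k * (St k n / d k)) else 0)"
      using irreducible_tridiagonal_inner[OF We ee, of _ m] that
      by (intro sum.cong) (auto simp: adjoint_works[OF linW] St d_def)
    finally have "\<rho> n * (St m n / d m) =
        (\<Sum>k\<le>N. if \<bar>int m - int k\<bar> \<le> 1 then d m * (We m k * (St k n / d k)) else 0) / d m"
      by simp
    also have "\<dots> = (\<Sum>k\<le>N. if \<bar>int m - int k\<bar> \<le> 1 then We m k * (St k n / d k) else 0)"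
      using d[OF that(1)] unfolding sum_divide_distrib by (intro sum.cong) auto
    finally show ?thesis
      by (subst (asm) sum_banded[OF that(1)]) (auto split: if_splits)
  qed
  have St_poly: "St m n = h m * St 0 n * poly (P m) (\<rho> n)" if "m \<le> N" "n \<le> N" for m n
  proof -
    have "St m n / d m = g m * (St 0 n / d 0) * poly (P m) (\<rho> n)"
      unfolding P_def g_def
    proof (rule transposed_recurrence_solution[where N = N and t = "\<lambda>m. St m n / d m"])
      show "\<rho> n * (St m n / d m) = We m (Suc m) * (St (Suc m) n / d (Suc m))
          + We m m * (St m n / d m)
          + (if 0 < m then We m (m - 1) * (St (m - 1) n / d (m - 1)) else 0)" if "m < N" for m
        using transposed[of m n] that \<open>n \<le> N\<close> by simp
    qed (use Wpos that in auto)
    then show ?thesis using d[OF that(1)] by (simp add: h_def field_simps)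
  qed

  \<comment> \<open>What remains of \<open>S m n * St k n / c n\<close> once both polynomials and
    the factor \<open>g k * d k\<close> are split off.\<close>
  define w where "w n = S 0 n * St 0 n / (c n * d 0)" for n
  have w: "w n > 0" if "n \<le> N" for n
  proof -
    have "c n = (\<Sum>m\<le>N. (f n \<bullet> es m) * (e m \<bullet> fs n) / (e m \<bullet> es m))"
      unfolding c_def
      using es ee by (intro biorthogonal_inner_expansion) (auto simp: eigenbasis_def)
    also have "\<dots> = (\<Sum>m\<le>N. St m n * S m n / d m)"
      by (simp add: S St d_def inner_commute)
    also have "\<dots> = (\<Sum>m\<le>N. S 0 n * St 0 n / d 0 * (g m * (poly (P m) (\<rho> n))\<^sup>2))"
    proof (intro sum.cong refl)
      fix m assume "m \<in> {..N}"
      then have "m \<le> N" by simp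
      then show "St m n * S m n / d m = S 0 n * St 0 n / d 0 * (g m * (poly (P m) (\<rho> n))\<^sup>2)"
        using d[of m] d[of 0] S_poly[of m n] St_poly[of m n] that
        by (simp add: h_def power2_eq_square)
    qed
    also have "\<dots> = S 0 n * St 0 n / d 0 * (\<Sum>m\<le>N. g m * (poly (P m) (\<rho> n))\<^sup>2)"
      by (simp add: sum_distrib_left)
    finally have "w n * (\<Sum>m\<le>N. g m * (poly (P m) (\<rho> n))\<^sup>2) = 1"
      using c[OF that] by (simp add: w_def field_simps)
    \<comment> \<open>The sign of \<open>S 0 n * St 0 n\<close> is not known beforehand. A product
      equal to 1 with a nonnegative sum forces \<open>w n\<close> to be positive, so
      \<open>S 0 n\<close> and \<open>St 0 n\<close> are nonzero as well.\<close>
    moreover have "(\<Sum>m\<le>N. g m * (poly (P m) (\<rho> n))\<^sup>2) \<ge> 0"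
      using g by (intro sum_nonneg) (auto simp: less_imp_le)
    ultimately show ?thesis
      by (metis mult_nonpos_nonneg not_less not_one_le_zero)
  qed
  have "(\<Sum>n\<le>N. w n * poly (P m) (\<rho> n) * poly (P k) (\<rho> n)) = 0 \<longleftrightarrow> m \<noteq> k"
    if "m \<le> N" "k \<le> N" for m k
  proof -
    have "e m \<bullet> es k = (\<Sum>n\<le>N. (e m \<bullet> fs n) * (f n \<bullet> es k) / (f n \<bullet> fs n))"
      using fs ff by (intro biorthogonal_inner_expansion) (auto simp: eigenbasis_def)
    also have "\<dots> = (\<Sum>n\<le>N. S m n * St k n / c n)"
      by (simp add: S St c_def inner_commute)
    also have "\<dots> = (\<Sum>n\<le>N. g k * d k * (w n * poly (P m) (\<rho> n) * poly (P k) (\<rho> n)))"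
    proof (intro sum.cong refl)
      fix n assume "n \<in> {..N}"
      then have "n \<le> N" by simp
      then show "S m n * St k n / c n = g k * d k * (w n * poly (P m) (\<rho> n) * poly (P k) (\<rho> n))"
        using S_poly[of m n] St_poly[of k n] that by (simp add: h_def w_def mult_ac)
    qed
    finally have "e m \<bullet> es k =
        g k * d k * (\<Sum>n\<le>N. w n * poly (P m) (\<rho> n) * poly (P k) (\<rho> n))"
      by (simp add: sum_distrib_left)
    \<comment> \<open>As \<open>g k * d k\<close> is nonzero, the weighted sum vanishes exactly when
      the pairing of \<open>e m\<close> with \<open>es k\<close> does.\<close>
    then show ?thesis
      using ee[OF that] g[of k] d[of k] that by auto
  qed
  then have orthogonal: "orthogonal_on_points N \<rho> P"
    unfolding orthogonal_on_points_def using w by (intro exI[of _ w]) blast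
  have degree: "degree (P m) = m" if "m \<le> N" for m
    using degree_tridiagonal_poly[where M = We, OF Wnz that] by (simp add: P_def)
  have P0: "P 0 = 1" by (simp add: P_def)
  have h: "h m \<noteq> 0" if "m \<le> N" for m
    using g[OF that] d[OF that] d[of 0] by (simp add: h_def)
  show ?thesis
    by (intro conjI allI impI exI[of _ P] exI[of _ h])
      (rule recurrence difference degree P0 orthogonal S_poly h St_poly; assumption)+
qed

end
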